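(* For each nonnegative integer $m$, $d_m(2m)=D_m$; that is, the number of alternating permutations of $[2m]$ having exactly $m$ fixed points equals the number of derangements of $[m]$. *)

theory Defs
  imports "HOL-Combinatorics.Permutations"
begin

(* The permutations of [n] are the functions p with p permutes {1..n}; such p also fixes
   every number outside {1..n}, so fixed points are always counted inside {1..n}. *)

definition fixed_points :: "nat \<Rightarrow> (nat \<Rightarrow> nat) \<Rightarrow> nat set" where
  "fixed_points n p = {i \<in> {1..n}. p i = i}"

(* Stanley's convention: alternating means p 1 > p 2 < p 3 > p 4 < ...
   The opposite convention p 1 < p 2 > p 3 < ... gives "reverse alternating" permutations. *)
definition alternating :: "nat \<Rightarrow> (nat \<Rightarrow> nat) \<Rightarrow> bool" where
  "alternating n p \<longleftrightarrow>
     p permutes {1..n} \<and>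
     (\<forall>i. 1 \<le> i \<and> i < n \<longrightarrow> (if odd i then p i > p (i + 1) else p i < p (i + 1)))"

definition alternating_count :: "nat \<Rightarrow> nat \<Rightarrow> nat" where
  "alternating_count k n = card {p. alternating n p \<and> card (fixed_points n p) = k}"

definition derangement_count :: "nat \<Rightarrow> nat" where
  "derangement_count n = card {p. p permutes {1..n} \<and> fixed_points n p = {}}"

end

(* An alternating permutation p of [2m] satisfies p (2i - 1) > p (2i), so it fixes at most one
   element of each pair {2i - 1, 2i}; having m fixed points, it fixes exactly one of each pair.
   Numbering the pairs turns the restriction of p to its m moved points into a derangement t of
   [m].  Conversely t determines p: the moved point of the i-th pair must be 2i - 1 if t i > i
   and 2i if t i < i, and with this choice all the inequalities of an alternating permutation
   hold, because p (2i) <= 2i and p (2i + 1) >= 2i + 1. *)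

theory Submission
  imports Defs
begin

section \<open>Pairs, slots, and the two maps between permutations of [m] and of [2m]\<close>

definition pair_index :: "nat \<Rightarrow> nat" where
  "pair_index x = (x + 1) div 2"

definition slot :: "(nat \<Rightarrow> nat) \<Rightarrow> nat \<Rightarrow> nat" where
  "slot t i = (if t i > i then 2 * i - 1 else 2 * i)"

text \<open>Transport of \<open>t\<close> along the injection \<open>slot t\<close>:
  \<open>map_permutation\<close> is the identity off the image, so the remaining point of each pair
  becomes fixed.\<close>

definition inflate :: "nat \<Rightarrow> (nat \<Rightarrow> nat) \<Rightarrow> nat \<Rightarrow> nat" where
  "inflate m t = map_permutation {1..m} (slot t) t"

text \<open>The domain is the set of moved points because \<open>pair_index\<close>, which merges
  the two points of a pair, is injective there for the \<open>p\<close> of interest.\<close>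

definition deflate :: "(nat \<Rightarrow> nat) \<Rightarrow> nat \<Rightarrow> nat" where
  "deflate p = map_permutation {x. p x \<noteq> x} pair_index p"

text \<open>This holds even at 0, where truncated subtraction makes both branches of
  \<open>slot\<close> equal 0. Having a left inverse, \<open>slot t\<close> is injective on all
  naturals.\<close>

lemma pair_index_slot [simp]: "pair_index (slot t i) = i"
  by (auto simp: pair_index_def slot_def)

lemma inj_slot: "inj (slot t)"
  by (metis injI pair_index_slot)

lemma slot_mem: "i \<in> {1..m} \<Longrightarrow> slot t i \<in> {1..2 * m}"
  by (auto simp: slot_def)

text \<open>An odd position opens a pair and an even one closes it, so each inequality lies either
  inside a pair or between the end of a pair and the start of the next. Nothing follows the last
  pair, hence \<open>{1..<m}\<close>.\<close>

lemma alternating_iff: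
  "alternating (2 * m) p \<longleftrightarrow> p permutes {1..2 * m} \<and>
     (\<forall>i\<in>{1..m}. p (2 * i) < p (2 * i - 1)) \<and>
     (\<forall>i\<in>{1..<m}. p (2 * i) < p (2 * i + 1))"
  (is "?L \<longleftrightarrow> ?P \<and> ?D \<and> ?A")
proof
  assume L: ?L
  have ?D
  proof
    fix i assume "i \<in> {1..m}"
    then have "1 \<le> 2 * i - 1" "2 * i - 1 < 2 * m" "odd (2 * i - 1)" "2 * i - 1 + 1 = 2 * i"
      by auto
    with L show "p (2 * i) < p (2 * i - 1)"
      unfolding alternating_def by metis
  qed
  moreover have ?A
  proof
    fix i assume "i \<in> {1..<m}"
    then have "1 \<le> 2 * i" "2 * i < 2 * m" "even (2 * i)"
      by auto
    with L show "p (2 * i) < p (2 * i + 1)"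
      unfolding alternating_def by metis
  qed
  ultimately show "?P \<and> ?D \<and> ?A"
    using L unfolding alternating_def by blast
next
  assume R: "?P \<and> ?D \<and> ?A"
  have "if odd i then p i > p (i + 1) else p i < p (i + 1)" if i: "1 \<le> i" "i < 2 * m" for i
  proof (cases "odd i")
    case True
    then obtain k where "i = 2 * k + 1" by (rule oddE)
    with i have "k + 1 \<in> {1..m}" by simp
    with R have "p (2 * (k + 1)) < p (2 * (k + 1) - 1)" by blast
    with \<open>i = 2 * k + 1\<close> show ?thesis by simp
  next
    case False
    then obtain k where "i = 2 * k" by auto
    with i R show ?thesis by auto
  qed
  with R show ?L
    unfolding alternating_def by blast
qed

lemma fixed_points_eq_Diff: "fixed_points n p = {1..n} - {x. p x \<noteq> x}"
  by (auto simp: fixed_points_def)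

lemma moved_subset: "p permutes A \<Longrightarrow> {x. p x \<noteq> x} \<subseteq> A"
  using permutes_not_in by fastforce

lemma permutes_moved: "p permutes A \<Longrightarrow> p permutes {x. p x \<noteq> x}"
  by (rule permutes_superset) auto

section \<open>From derangements of [m] to alternating permutations of [2m]\<close>

context
  fixes m :: nat and t :: "nat \<Rightarrow> nat"
  assumes perm: "t permutes {1..m}" and derangement: "fixed_points m t = {}"
begin

lemma derangement_neq: "i \<in> {1..m} \<Longrightarrow> t i \<noteq> i"
  using derangement by (auto simp: fixed_points_def)

lemma bij_betw_slot: "bij_betw (slot t) {1..m} (slot t ` {1..m})"
  using inj_slot by (meson bij_betw_imageI inj_on_subset subset_UNIV)

lemma inflate_slot: "i \<in> {1..m} \<Longrightarrow> inflate m t (slot t i) = slot t (t i)"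
  unfolding inflate_def
  by (rule map_permutation_apply) (use inj_slot in \<open>auto intro: inj_on_subset\<close>)

lemma inflate_other: "x \<notin> slot t ` {1..m} \<Longrightarrow> inflate m t x = x"
  unfolding inflate_def map_permutation_def by simp

lemma moved_inflate: "{x. inflate m t x \<noteq> x} = slot t ` {1..m}"
proof (intro subset_antisym subsetI)
  fix x assume "x \<in> {x. inflate m t x \<noteq> x}"
  then show "x \<in> slot t ` {1..m}" using inflate_other by blast
next
  fix x assume "x \<in> slot t ` {1..m}"
  then obtain i where i: "i \<in> {1..m}" "x = slot t i" by blast
  then have "inflate m t x = slot t (t i)" by (simp only: inflate_slot)
  with i derangement_neq show "x \<in> {x. inflate m t x \<noteq> x}"
    using inj_slot by (auto dest: injD)
qed

lemma inflate_permutes: "inflate m t permutes {1..2 * m}"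
proof (rule permutes_subset)
  show "inflate m t permutes slot t ` {1..m}"
    unfolding inflate_def by (rule map_permutation_permutes[OF bij_betw_slot perm])
  show "slot t ` {1..m} \<subseteq> {1..2 * m}" using slot_mem by blast
qed

text \<open>The slot \<open>2 * i - 1\<close> goes to the slot of a later pair, hence beyond
  \<open>2 * i\<close>. The point \<open>2 * i\<close> is not a slot, since a slot in pair
  \<open>i\<close> can only be that of \<open>i\<close>.\<close>

lemma inflate_excedance:
  assumes i: "i \<in> {1..m}" and "t i > i"
  shows "inflate m t (2 * i - 1) > 2 * i" and "inflate m t (2 * i) = 2 * i"
proof -
  have s: "slot t i = 2 * i - 1" using assms by (simp add: slot_def)
  have "slot t (t i) > 2 * i" using assms by (auto simp: slot_def)
  then show "inflate m t (2 * i - 1) > 2 * i" using inflate_slot[OF i] s by simp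
  have "2 * i \<notin> slot t ` {1..m}"
  proof
    assume "2 * i \<in> slot t ` {1..m}"
    then obtain j where j: "2 * i = slot t j" by blast
    have "pair_index (2 * i) = i" by (simp add: pair_index_def)
    with j have "j = i" by simp
    with j s i show False by auto
  qed
  then show "inflate m t (2 * i) = 2 * i" by (rule inflate_other)
qed

lemma inflate_anti_excedance:
  assumes i: "i \<in> {1..m}" and "t i < i"
  shows "inflate m t (2 * i) < 2 * i - 1" and "inflate m t (2 * i - 1) = 2 * i - 1"
proof -
  have s: "slot t i = 2 * i" using assms by (simp add: slot_def)
  have "slot t (t i) < 2 * i - 1" using assms by (auto simp: slot_def)
  then show "inflate m t (2 * i) < 2 * i - 1" using inflate_slot[OF i] s by simp
  have "2 * i - 1 \<notin> slot t ` {1..m}"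
  proof
    assume "2 * i - 1 \<in> slot t ` {1..m}"
    then obtain j where j: "2 * i - 1 = slot t j" by blast
    have "pair_index (2 * i - 1) = i" using i by (simp add: pair_index_def)
    with j have "j = i" by simp
    with j s i show False by auto
  qed
  then show "inflate m t (2 * i - 1) = 2 * i - 1" by (rule inflate_other)
qed

text \<open>The weak bounds separate neighbouring pairs without comparing \<open>t\<close> at
  neighbouring arguments; they yield the ascents in \<open>alternating_inflate\<close>.\<close>

lemma inflate_bounds:
  assumes "i \<in> {1..m}"
  shows "inflate m t (2 * i) < inflate m t (2 * i - 1)"
    and "inflate m t (2 * i) \<le> 2 * i" and "2 * i - 1 \<le> inflate m t (2 * i - 1)"
proof -
  consider "t i > i" | "t i < i" using derangement_neq[OF assms] by linarith
  then have "inflate m t (2 * i) < inflate m t (2 * i - 1) \<and>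
    inflate m t (2 * i) \<le> 2 * i \<and> 2 * i - 1 \<le> inflate m t (2 * i - 1)"
  proof cases
    case 1
    with inflate_excedance[OF assms] show ?thesis by simp
  next
    case 2
    with inflate_anti_excedance[OF assms] show ?thesis by simp
  qed
  then show "inflate m t (2 * i) < inflate m t (2 * i - 1)"
    "inflate m t (2 * i) \<le> 2 * i" "2 * i - 1 \<le> inflate m t (2 * i - 1)" by auto
qed

lemma alternating_inflate: "alternating (2 * m) (inflate m t)"
  unfolding alternating_iff
proof (intro conjI ballI inflate_permutes inflate_bounds(1))
  fix i assume "i \<in> {1..<m}"
  then have "i \<in> {1..m}" "i + 1 \<in> {1..m}" by auto
  then have "inflate m t (2 * i) \<le> 2 * i" "2 * i + 1 \<le> inflate m t (2 * i + 1)"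
    using inflate_bounds(2)[of i] inflate_bounds(3)[of "i + 1"] by auto
  then show "inflate m t (2 * i) < inflate m t (2 * i + 1)" by simp
qed

lemma card_fixed_points_inflate: "card (fixed_points (2 * m) (inflate m t)) = m"
proof -
  have "slot t ` {1..m} \<subseteq> {1..2 * m}" using slot_mem by blast
  moreover have "card (slot t ` {1..m}) = m"
    using bij_betw_slot by (metis bij_betw_same_card card_atLeastAtMost diff_Suc_1)
  ultimately show ?thesis
    unfolding fixed_points_eq_Diff moved_inflate by (simp add: card_Diff_subset)
qed

lemma deflate_inflate: "deflate (inflate m t) = t"
  \<comment> \<open>\<open>moved_inflate\<close> has to act while the set of moved points is still
    expressed through \<open>inflate\<close>. What remains is transport along \<open>slot t\<close>
    and back along its left inverse \<open>pair_index\<close>.\<close>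
  unfolding deflate_def moved_inflate unfolding inflate_def
  by (rule map_permutation_compose_inv[OF bij_betw_slot perm]) simp

end

section \<open>From alternating permutations of [2m] with m fixed points to derangements of
  [m]\<close>

lemma pair_index_mono: "x \<le> y \<Longrightarrow> pair_index x \<le> pair_index y"
  by (simp add: pair_index_def div_le_mono)

lemma pair_index_mem: "x \<in> {1..2 * m} \<Longrightarrow> pair_index x \<in> {1..m}"
  by (auto simp: pair_index_def)

lemma pair_index_eqD: "pair_index x = i \<Longrightarrow> x = 2 * i - 1 \<or> x = 2 * i"
  unfolding pair_index_def by linarith

context
  fixes m :: nat and p :: "nat \<Rightarrow> nat"
  assumes alt: "alternating (2 * m) p" and fixed: "card (fixed_points (2 * m) p) = m"
begin

lemma alternating_permutes: "p permutes {1..2 * m}"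
  using alt by (simp add: alternating_iff)

lemma alternating_descent: "i \<in> {1..m} \<Longrightarrow> p (2 * i) < p (2 * i - 1)"
  using alt by (simp add: alternating_iff)

text \<open>Pigeonhole: two fixed points in one pair would contradict the descent there, so the m
  fixed points occupy m distinct pairs out of m.\<close>

lemma pair_index_fixed_points: "pair_index ` fixed_points (2 * m) p = {1..m}"
proof (rule card_subset_eq)
  have "inj_on pair_index (fixed_points (2 * m) p)"
  proof
    fix x y
    assume x: "x \<in> fixed_points (2 * m) p" and y: "y \<in> fixed_points (2 * m) p"
      and eq: "pair_index x = pair_index y"
    have "x \<in> {1..2 * m}" using x by (simp add: fixed_points_def)
    then have "p (2 * pair_index x) < p (2 * pair_index x - 1)"
      by (intro alternating_descent pair_index_mem)
    moreover have "p x = x" "p y = y" using x y by (simp_all add: fixed_points_def)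
    ultimately show "x = y"
      using pair_index_eqD[of x "pair_index x"] pair_index_eqD[of y "pair_index x"] eq by force
  qed
  then show "card (pair_index ` fixed_points (2 * m) p) = card {1..m}"
    by (simp add: card_image fixed)
  show "pair_index ` fixed_points (2 * m) p \<subseteq> {1..m}"
    using pair_index_mem by (auto simp: fixed_points_def)
qed simp

text \<open>Once one point of the pair is fixed, the descent pushes the other out of the pair:
  \<open>2 * i\<close> downwards or \<open>2 * i - 1\<close> upwards.\<close>

lemma fixed_in_pair:
  assumes "i \<in> {1..m}"
  shows "(p (2 * i - 1) = 2 * i - 1 \<and> p (2 * i) < 2 * i - 1) \<or>
    (p (2 * i) = 2 * i \<and> 2 * i < p (2 * i - 1))"
proof -
  obtain x where "x \<in> fixed_points (2 * m) p" "pair_index x = i"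
    using assms pair_index_fixed_points by (metis imageE)
  then have "p x = x" "x = 2 * i - 1 \<or> x = 2 * i"
    using pair_index_eqD by (auto simp: fixed_points_def)
  then show ?thesis using alternating_descent[OF assms] by auto
qed

text \<open>The direction in which a point moves reveals its place in its pair; the case split
  mirrors \<open>slot\<close>.\<close>

lemma moved_in_pair:
  assumes "p x \<noteq> x"
  shows "pair_index x \<in> {1..m}"
    and "x = (if p x > x then 2 * pair_index x - 1 else 2 * pair_index x)"
proof -
  have "x \<in> {1..2 * m}" using assms alternating_permutes permutes_not_in by metis
  then show i: "pair_index x \<in> {1..m}" by (rule pair_index_mem)
  have "x = 2 * pair_index x - 1 \<or> x = 2 * pair_index x" by (rule pair_index_eqD) simp
  then show "x = (if p x > x then 2 * pair_index x - 1 else 2 * pair_index x)"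
  proof
    assume x: "x = 2 * pair_index x - 1"
    with assms fixed_in_pair[OF i] have "p x > x" by auto
    with x show ?thesis by simp
  next
    assume x: "x = 2 * pair_index x"
    with assms fixed_in_pair[OF i] have "p x < x" by auto
    with x show ?thesis by simp
  qed
qed

text \<open>Injective because one point of each pair is fixed, onto because the other is
  not.\<close>

lemma bij_betw_pair_index: "bij_betw pair_index {x. p x \<noteq> x} {1..m}"
proof (rule bij_betwI')
  fix x y assume x: "x \<in> {x. p x \<noteq> x}" and y: "y \<in> {x. p x \<noteq> x}"
  show "(pair_index x = pair_index y) = (x = y)"
  proof
    assume eq: "pair_index x = pair_index y"
    have "x = 2 * pair_index x - 1 \<or> x = 2 * pair_index x"
      "y = 2 * pair_index x - 1 \<or> y = 2 * pair_index x"
      using pair_index_eqD[OF refl] pair_index_eqD[OF eq[symmetric]] by blast+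
    moreover have "p (2 * pair_index x - 1) = 2 * pair_index x - 1 \<or>
      p (2 * pair_index x) = 2 * pair_index x"
      using x fixed_in_pair moved_in_pair(1) by blast
    ultimately show "x = y" using x y by auto
  qed simp
next
  fix x assume "x \<in> {x. p x \<noteq> x}"
  then show "pair_index x \<in> {1..m}" using moved_in_pair(1) by blast
next
  fix i assume i: "i \<in> {1..m}"
  then have "pair_index (2 * i - 1) = i" "pair_index (2 * i) = i"
    by (auto simp: pair_index_def)
  moreover have "p (2 * i - 1) \<noteq> 2 * i - 1 \<or> p (2 * i) \<noteq> 2 * i"
    using fixed_in_pair[OF i] by auto
  ultimately show "\<exists>x\<in>{x. p x \<noteq> x}. i = pair_index x" by auto
qed

lemma deflate_permutes: "deflate p permutes {1..m}"
  unfolding deflate_def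
  by (rule map_permutation_permutes[OF bij_betw_pair_index permutes_moved[OF alternating_permutes]])

lemma deflate_pair_index:
  assumes "p x \<noteq> x"
  shows "deflate p (pair_index x) = pair_index (p x)"
  unfolding deflate_def
  by (rule map_permutation_apply) (use bij_betw_pair_index assms in \<open>auto simp: bij_betw_def\<close>)

lemma moved_image:
  assumes "p x \<noteq> x" shows "p (p x) \<noteq> p x"
  using assms alternating_permutes by (metis permutes_def)

text \<open>Both \<open>x\<close> and \<open>p x\<close> are moved, and a pair contains only one
  moved point.\<close>

lemma pair_index_image_neq:
  assumes "p x \<noteq> x" shows "pair_index (p x) \<noteq> pair_index x"
  using bij_betw_pair_index assms moved_image[OF assms]
  by (auto simp: bij_betw_def dest: inj_onD)

lemma deflate_derangement: "fixed_points m (deflate p) = {}"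
proof -
  have "deflate p i \<noteq> i" if i: "i \<in> {1..m}" for i
  proof -
    obtain x where "p x \<noteq> x" "i = pair_index x"
      using i bij_betw_pair_index unfolding bij_betw_def by blast
    then show ?thesis using deflate_pair_index pair_index_image_neq by simp
  qed
  then show ?thesis by (auto simp: fixed_points_def)
qed

lemma slot_deflate:
  assumes "p x \<noteq> x"
  shows "slot (deflate p) (pair_index x) = x"
proof -
  \<comment> \<open>The test made by \<open>slot\<close> compares pair indices. It agrees with
    comparing \<open>x\<close> and \<open>p x\<close>, as \<open>pair_index\<close> is monotone and
    the two indices differ.\<close>
  have "pair_index x < pair_index (p x) \<longleftrightarrow> x < p x"
    using pair_index_image_neq[OF assms] pair_index_mono[of x "p x"] pair_index_mono[of "p x" x]
    by linarith
  then show ?thesis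
    unfolding slot_def deflate_pair_index[OF assms] using moved_in_pair(2)[OF assms] by simp
qed

lemma inflate_deflate: "inflate m (deflate p) = p"
  unfolding inflate_def
  \<comment> \<open>Only the transported permutation is unfolded; inside \<open>slot\<close>,
    \<open>deflate p\<close> stays folded, so that \<open>slot_deflate\<close> shows
    \<open>slot (deflate p)\<close> to undo \<open>pair_index\<close> on moved points.\<close>
  by (subst (2) deflate_def)
    (rule map_permutation_compose_inv[OF bij_betw_pair_index permutes_moved[OF alternating_permutes]],
      simp add: slot_deflate)

end

theorem theorem2p1:
  fixes m :: nat
  shows "alternating_count m (2 * m) = derangement_count m"
proof -
  have "bij_betw deflate {p. alternating (2 * m) p \<and> card (fixed_points (2 * m) p) = m}
    {t. t permutes {1..m} \<and> fixed_points m t = {}}"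
    by (rule bij_betw_byWitness[where f' = "inflate m"])
      (auto simp: inflate_deflate deflate_inflate deflate_permutes deflate_derangement
        alternating_inflate card_fixed_points_inflate simp del: One_nat_def)
  then show ?thesis
    unfolding alternating_count_def derangement_count_def by (rule bij_betw_same_card)
qed

end
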